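(* Each of the following groups has some non $\mathcal{P}$-interval metric, i.e. admits an invariant metric which is not $\mathcal{P}$-interval: (a) the cyclic groups $\mathbb{Z}_{2n}$ for $n\ge 7$, the dihedral groups $\mathbb{D}_n$ for $n\ge 4$, the dicyclic groups $\mathbb{Q}_{4n}$ for $n\ge 3$, and the symmetric groups $\mathbb{S}_n$ for $n\ge 4$; (b) the groups $\mathbb{Z}_2^r$ for any $r\ge 3$, and $G\times\mathbb{Z}_2^r$ for any non-trivial finite group $G$ and $r\ge 2$.
   Context: $\mathbb{D}_n=\langle\rho,\tau: \rho^n=\tau^2=(\tau\rho)^2=e\rangle$ is the dihedral group of order $2n$; $\mathbb{Q}_{4n}=\langle x,y: x^{2n}=e,\ y^2=x^n,\ y^{-1}xy=x^{-1}\rangle$ is the dicyclic group of order $4n$; $\mathbb{S}_n$ is the symmetric group on $n$ letters. All metrics on groups are integral (integer valued) and right translation invariant: $d(gh,g'h)=d(g,g')$ for all $g,g',h\in G$. The weight of $d$ is $w(x)=d(x,e)$, $e$ the identity. The partition induced by $d$, denoted $P(G,d)$, is the set of classes of the equivalence relation $g\sim h\Leftrightarrow w(g)=w(h)$. An interval metric is such a metric $d$ with finitely many weights and without gaps: if $P(G,d)$ has $m$ parts different from $\{e\}$, then the set of values of $w$ is exactly $\{0,1,\ldots,m\}$. A metric $d$ on $G$ is $\mathcal{P}$-interval if there is an interval metric $d'$ on $G$ with $P(G,d)=P(G,d')$. *)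

theory Defs
  imports "HOL-Algebra.Product_Groups" "HOL-Algebra.Elementary_Groups" "HOL-Algebra.Sym_Groups"
    "HOL-Analysis.Abstract_Metric_Spaces"
begin

section \<open>Invariant integral metrics and interval metrics\<close>

text \<open>
  \<open>Metric_space\<close> also asks for nonnegativity and symmetry of \<open>d\<close> outside \<open>carrier G\<close>.  This costs
  nothing: all notions below only see \<open>d\<close> on \<open>carrier G\<close>, and \<open>d\<close> can be set to 0 elsewhere.
\<close>

definition invariant_metric :: "('a, 'b) monoid_scheme \<Rightarrow> ('a \<Rightarrow> 'a \<Rightarrow> real) \<Rightarrow> bool" where
  "invariant_metric G d \<longleftrightarrow>
     Metric_space (carrier G) d \<and>
     (\<forall>g \<in> carrier G. \<forall>g' \<in> carrier G. d g g' \<in> \<int>) \<and>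
     (\<forall>g \<in> carrier G. \<forall>g' \<in> carrier G. \<forall>h \<in> carrier G.
        d (g \<otimes>\<^bsub>G\<^esub> h) (g' \<otimes>\<^bsub>G\<^esub> h) = d g g')"

definition weight :: "('a, 'b) monoid_scheme \<Rightarrow> ('a \<Rightarrow> 'a \<Rightarrow> real) \<Rightarrow> 'a \<Rightarrow> real" where
  "weight G d x = d x \<one>\<^bsub>G\<^esub>"

definition metric_partition :: "('a, 'b) monoid_scheme \<Rightarrow> ('a \<Rightarrow> 'a \<Rightarrow> real) \<Rightarrow> 'a set set" where
  "metric_partition G d =
     carrier G // {(g, h). g \<in> carrier G \<and> h \<in> carrier G \<and> weight G d g = weight G d h}"

definition interval_metric :: "('a, 'b) monoid_scheme \<Rightarrow> ('a \<Rightarrow> 'a \<Rightarrow> real) \<Rightarrow> bool" where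
  "interval_metric G d \<longleftrightarrow>
     invariant_metric G d \<and>
     finite (weight G d ` carrier G) \<and>
     weight G d ` carrier G = real ` {0..card (metric_partition G d - {{\<one>\<^bsub>G\<^esub>}})}"

definition P_interval :: "('a, 'b) monoid_scheme \<Rightarrow> ('a \<Rightarrow> 'a \<Rightarrow> real) \<Rightarrow> bool" where
  "P_interval G d \<longleftrightarrow>
     (\<exists>d'. interval_metric G d' \<and> metric_partition G d = metric_partition G d')"

definition has_non_P_interval_metric :: "('a, 'b) monoid_scheme \<Rightarrow> bool" where
  "has_non_P_interval_metric G \<longleftrightarrow> (\<exists>d. invariant_metric G d \<and> \<not> P_interval G d)"


section \<open>Groups given by generators and relations\<close>

text \<open>
  A word over the generators \<open>'g\<close> is a list of letters; the letter \<open>(g, True)\<close> stands for \<open>g\<close>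
  and \<open>(g, False)\<close> for its formal inverse.  A relation \<open>u = v\<close> is the pair \<open>(u, v)\<close>.
  The presented group consists of the words modulo the least congruence that contains the
  relations and free cancellation; every element of \<open>'g\<close> is a generator.
\<close>

type_synonym 'g word = "('g \<times> bool) list"

inductive word_eq :: "('g word \<times> 'g word) set \<Rightarrow> 'g word \<Rightarrow> 'g word \<Rightarrow> bool"
  for R :: "('g word \<times> 'g word) set" where
  rel: "(u, v) \<in> R \<Longrightarrow> word_eq R u v"
| cancel: "word_eq R [(g, b), (g, \<not> b)] []"
| refl: "word_eq R u u"
| sym: "word_eq R u v \<Longrightarrow> word_eq R v u"
| trans: "word_eq R u v \<Longrightarrow> word_eq R v w \<Longrightarrow> word_eq R u w"
| append: "word_eq R u u' \<Longrightarrow> word_eq R v v' \<Longrightarrow> word_eq R (u @ v) (u' @ v')"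

definition word_class :: "('g word \<times> 'g word) set \<Rightarrow> 'g word \<Rightarrow> 'g word set" where
  "word_class R u = {v. word_eq R u v}"

definition presented_group :: "('g word \<times> 'g word) set \<Rightarrow> 'g word set monoid" where
  "presented_group R =
     \<lparr>carrier = range (word_class R),
      monoid.mult = (\<lambda>A B. \<Union>u \<in> A. \<Union>v \<in> B. word_class R (u @ v)),
      one = word_class R []\<rparr>"

lemma word_class_eq_iff: "word_class R u = word_class R v \<longleftrightarrow> word_eq R u v"
proof
  assume "word_class R u = word_class R v"
  then have "v \<in> word_class R u"
    by (simp add: word_class_def word_eq.refl)
  then show "word_eq R u v"
    by (simp add: word_class_def)
next
  assume "word_eq R u v"
  then show "word_class R u = word_class R v"
    unfolding word_class_def using word_eq.sym word_eq.trans by blast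
qed

lemma presented_group_mult:
  "word_class R u \<otimes>\<^bsub>presented_group R\<^esub> word_class R v = word_class R (u @ v)"
proof -
  have eq: "word_class R (u' @ v') = word_class R (u @ v)"
    if "u' \<in> word_class R u" "v' \<in> word_class R v" for u' v'
  proof -
    have "word_eq R u u'" "word_eq R v v'"
      using that by (simp_all add: word_class_def)
    then show ?thesis
      unfolding word_class_eq_iff by (rule word_eq.sym[OF word_eq.append])
  qed
  have mem: "w \<in> word_class R w" for w
    by (simp add: word_class_def word_eq.refl)
  have "(\<Union>u' \<in> word_class R u. \<Union>v' \<in> word_class R v. word_class R (u' @ v'))
        = (\<Union>u' \<in> word_class R u. \<Union>v' \<in> word_class R v. word_class R (u @ v))"
    by (intro SUP_cong HOL.refl eq)
  also have "\<dots> = word_class R (u @ v)"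
    using mem by blast
  finally show ?thesis
    by (simp add: presented_group_def)
qed

lemma word_eq_inverse: "word_eq R (map (\<lambda>(g, b). (g, \<not> b)) (rev u) @ u) []"
proof (induction u)
  case Nil
  then show ?case by (simp add: word_eq.refl)
next
  case (Cons a u)
  obtain g b where a: "a = (g, b)" by (cases a)
  let ?w = "map (\<lambda>(g, b). (g, \<not> b)) (rev u)"
  have "word_eq R ([(g, \<not> b), (g, b)] @ u) ([] @ u)"
    using word_eq.append[OF word_eq.cancel[of R g "\<not> b"] word_eq.refl[of R u]] by simp
  then have "word_eq R (?w @ [(g, \<not> b), (g, b)] @ u) (?w @ u)"
    using word_eq.append[OF word_eq.refl[of R ?w]] by simp
  from word_eq.trans[OF this Cons.IH] show ?case
    by (simp add: a)
qed

lemma group_presented_group: "group (presented_group R)"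
proof (rule groupI)
  fix x assume "x \<in> carrier (presented_group R)"
  then obtain u where x: "x = word_class R u"
    by (auto simp: presented_group_def)
  show "\<exists>y \<in> carrier (presented_group R). y \<otimes>\<^bsub>presented_group R\<^esub> x = \<one>\<^bsub>presented_group R\<^esub>"
  proof
    show "word_class R (map (\<lambda>(g, b). (g, \<not> b)) (rev u)) \<otimes>\<^bsub>presented_group R\<^esub> x
          = \<one>\<^bsub>presented_group R\<^esub>"
      using word_eq_inverse[of R u]
      by (simp add: x presented_group_mult word_class_eq_iff) (simp add: presented_group_def word_class_eq_iff)
  qed (simp add: presented_group_def)
next
  fix x assume "x \<in> carrier (presented_group R)"
  then obtain u where x: "x = word_class R u"
    by (auto simp: presented_group_def)
  have "\<one>\<^bsub>presented_group R\<^esub> = word_class R []"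
    by (simp add: presented_group_def)
  then show "\<one>\<^bsub>presented_group R\<^esub> \<otimes>\<^bsub>presented_group R\<^esub> x = x"
    by (simp add: x presented_group_mult)
next
  fix x y
  assume "x \<in> carrier (presented_group R)" "y \<in> carrier (presented_group R)"
  then obtain u v where "x = word_class R u" "y = word_class R v"
    by (auto simp: presented_group_def)
  then show "x \<otimes>\<^bsub>presented_group R\<^esub> y \<in> carrier (presented_group R)"
    by (simp add: presented_group_mult) (simp add: presented_group_def)
next
  fix x y z
  assume "x \<in> carrier (presented_group R)" "y \<in> carrier (presented_group R)"
    "z \<in> carrier (presented_group R)"
  then obtain u v w where "x = word_class R u" "y = word_class R v" "z = word_class R w"
    by (auto simp: presented_group_def)
  then show "x \<otimes>\<^bsub>presented_group R\<^esub> y \<otimes>\<^bsub>presented_group R\<^esub> z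
             = x \<otimes>\<^bsub>presented_group R\<^esub> (y \<otimes>\<^bsub>presented_group R\<^esub> z)"
    by (simp add: presented_group_mult)
qed (simp add: presented_group_def)


section \<open>Dihedral groups, dicyclic groups and elementary abelian 2-groups\<close>

datatype dihedral_gen = Rho | Tau

definition dihedral_group :: "nat \<Rightarrow> dihedral_gen word set monoid" where
  "dihedral_group n = presented_group
     {(replicate n (Rho, True), []),
      ([(Tau, True), (Tau, True)], []),
      ([(Tau, True), (Rho, True), (Tau, True), (Rho, True)], [])}"

datatype dicyclic_gen = Dic_x | Dic_y

text \<open>\<open>dicyclic_group n\<close> is the dicyclic group of order \<open>4n\<close>.\<close>

definition dicyclic_group :: "nat \<Rightarrow> dicyclic_gen word set monoid" where
  "dicyclic_group n = presented_group
     {(replicate (2 * n) (Dic_x, True), []),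
      ([(Dic_y, True), (Dic_y, True)], replicate n (Dic_x, True)),
      ([(Dic_y, False), (Dic_x, True), (Dic_y, True)], [(Dic_x, False)])}"

definition Z2_power :: "nat \<Rightarrow> (nat \<Rightarrow> int) monoid" where
  "Z2_power r = product_group {..<r} (\<lambda>_. integer_mod_group 2)"

end

theory Submission imports Defs begin

text \<open>
  Every partition of \<open>G - {\<one>}\<close> into finitely many inverse-closed classes comes from some invariant
  metric.  Suppose there are four classes such that for any three of them \<open>X, Y, Z\<close> some product
  of an element of \<open>X\<close> and one of \<open>Y\<close> lies in \<open>Z\<close>.  In an interval metric with this partition the
  classes would have weights 1, 2, 3, 4, and the classes of weights 1, 2, 4 would violate the
  triangle inequality.  It remains to find such classes; the last one is always the rest of the
  group.  If \<open>x y x = y\<close>, \<open>x\<^sup>2 \<noteq> \<one>\<close>, \<open>x\<^sup>3 \<noteq> \<one>\<close> and \<open>y\<^sup>2 \<noteq> x\<^sup>2\<close>, take the classes of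
  \<open>x\<close>, of \<open>x\<^sup>2\<close> and \<open>y\<close>, and of \<open>x y\<close>; this covers the dihedral, dicyclic and symmetric groups.
  In a cyclic group take \<open>{\<plusminus>1}\<close>, \<open>{\<plusminus>2, \<plusminus>6}\<close>, \<open>{\<plusminus>3}\<close>.  For \<open>g \<noteq> \<one>\<close> commuting with independent
  involutions \<open>u\<close>, \<open>v\<close>, take \<open>u v\<close>, then \<open>g\<^sup>\<plusminus>\<^sup>1 u v\<close> and \<open>v\<close>, then \<open>g\<^sup>\<plusminus>\<^sup>1 v\<close> and \<open>u\<close>.
\<close>

section \<open>Weights, partitions and the four-class criterion\<close>

text \<open>An equivalence relation can be read off its quotient: two elements are related exactly
  when some class contains both.\<close>

lemma quotient_eq_imp_rel_iff:
  assumes r: "equiv A r" and s: "equiv A s" and eq: "A // r = A // s"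
    and x: "x \<in> A" and y: "y \<in> A"
  shows "(x, y) \<in> r \<longleftrightarrow> (x, y) \<in> s"
proof -
  have "(x, y) \<in> t \<longleftrightarrow> (\<exists>X \<in> A // t. x \<in> X \<and> y \<in> X)" if t: "equiv A t" for t
  proof
    assume "(x, y) \<in> t"
    with t x show "\<exists>X \<in> A // t. x \<in> X \<and> y \<in> X"
      by (intro bexI[of _ "t `` {x}"]) (auto simp: quotientI elim: equivE refl_onD)
  next
    assume "\<exists>X \<in> A // t. x \<in> X \<and> y \<in> X"
    with t show "(x, y) \<in> t"
      by (meson quotient_eqI quotient_eq_iff)
  qed
  from this[OF r] this[OF s] eq show ?thesis
    by simp
qed

lemma metric_partition_eq_imp_weight_eq_iff:
  assumes "metric_partition G d = metric_partition G d'" "x \<in> carrier G" "y \<in> carrier G"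
  shows "weight G d x = weight G d y \<longleftrightarrow> weight G d' x = weight G d' y"
proof -
  have "equiv (carrier G) {(g, h). g \<in> carrier G \<and> h \<in> carrier G \<and> weight G e g = weight G e h}" for e
    by (auto intro!: equivI refl_onI symI transI)
  from quotient_eq_imp_rel_iff[OF this this assms(1)[unfolded metric_partition_def] assms(2,3)]
    assms(2,3) show ?thesis
    by simp
qed

context group
begin

text \<open>Right multiplication by \<open>y\<close> carries the pair \<open>x\<close>,
  \<open>\<one>\<close> to \<open>x \<otimes> y\<close>, \<open>y\<close>, so this is the triangle
  inequality through \<open>y\<close>.\<close>

lemma weight_mult_le:
  assumes d: "invariant_metric G d" and x: "x \<in> carrier G" and y: "y \<in> carrier G"
  shows "weight G d (x \<otimes> y) \<le> weight G d x + weight G d y"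
proof -
  interpret Metric_space "carrier G" d
    using d by (simp add: invariant_metric_def)
  have "d (x \<otimes> y) \<one> \<le> d (x \<otimes> y) (\<one> \<otimes> y) + d y \<one>"
    using triangle[of "x \<otimes> y" y \<one>] x y by simp
  also have "d (x \<otimes> y) (\<one> \<otimes> y) = d x \<one>"
    using d x y one_closed unfolding invariant_metric_def by blast
  finally show ?thesis
    by (simp add: weight_def)
qed

text \<open>The metric is the weight of \<open>x \<otimes> inv y\<close>, in which a common right
  factor cancels. Symmetry comes from \<open>inv\<close>, and the triangle inequality from (x
  y^-1)(y z^-1) = x z^-1.\<close>

lemma invariant_metric_of_weight:
  fixes w :: "'a \<Rightarrow> nat"
  assumes zero: "\<And>x. x \<in> carrier G \<Longrightarrow> w x = 0 \<longleftrightarrow> x = \<one>"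
    and inv: "\<And>x. x \<in> carrier G \<Longrightarrow> w (inv x) = w x"
    and sub: "\<And>x y. x \<in> carrier G \<Longrightarrow> y \<in> carrier G \<Longrightarrow> w (x \<otimes> y) \<le> w x + w y"
  obtains d where "invariant_metric G d" "\<And>x. x \<in> carrier G \<Longrightarrow> weight G d x = w x"
proof
  \<comment> \<open>The value 0 outside the carrier is there because \<open>Metric_space\<close>
    asks for symmetry and nonnegativity everywhere.\<close>
  define d :: "'a \<Rightarrow> 'a \<Rightarrow> real" where
    "d x y = (if x \<in> carrier G \<and> y \<in> carrier G then w (x \<otimes> inv y) else 0)" for x y
  have "Metric_space (carrier G) d"
  proof
    fix x y
    have "w (x \<otimes> inv y) = w (y \<otimes> inv x)" if "x \<in> carrier G" "y \<in> carrier G"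
      using inv[of "x \<otimes> inv y"] that by (simp add: inv_mult_group)
    then show "d x y = d y x"
      by (simp add: d_def)
  next
    fix x y assume xy: "x \<in> carrier G" "y \<in> carrier G"
    then have "x \<otimes> inv y = \<one> \<longleftrightarrow> x = y"
      by (metis inv_closed inv_inv inv_solve_right l_one one_closed)
    with xy show "d x y = 0 \<longleftrightarrow> x = y"
      by (simp add: d_def zero)
  next
    fix x y z assume xyz: "x \<in> carrier G" "y \<in> carrier G" "z \<in> carrier G"
    then have "(x \<otimes> inv y) \<otimes> (y \<otimes> inv z) = x \<otimes> inv z"
      by (metis inv_closed inv_solve_left m_assoc m_closed)
    with sub[of "x \<otimes> inv y" "y \<otimes> inv z"] xyz show "d x z \<le> d x y + d y z"
      by (simp add: d_def flip: of_nat_add)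
  qed (simp add: d_def)
  moreover have "d (g \<otimes> h) (g' \<otimes> h) = d g g'"
    if "g \<in> carrier G" "g' \<in> carrier G" "h \<in> carrier G" for g g' h
  proof -
    have "h \<otimes> (inv h \<otimes> inv g') = inv g'"
      using that by (simp flip: m_assoc)
    then have "(g \<otimes> h) \<otimes> inv (g' \<otimes> h) = g \<otimes> inv g'"
      using that by (simp add: inv_mult_group m_assoc)
    with that show ?thesis
      by (simp add: d_def)
  qed
  ultimately show "invariant_metric G d"
    by (simp add: invariant_metric_def d_def)
  show "weight G d x = w x" if "x \<in> carrier G" for x
    using that by (simp add: weight_def d_def)
qed

text \<open>
  The weights \<open>m + c x\<close> lie in an interval \<open>[k, 2k]\<close> and so satisfy the triangle inequality
  whatever the colouring \<open>c\<close>; an interval metric with the same partition amounts to a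
  renumbering \<open>f\<close> of the colours.
\<close>

lemma has_non_P_interval_metricI:
  fixes c :: "'a \<Rightarrow> nat"
  assumes range: "c ` carrier G = {0..m}"
    and zero: "\<And>x. x \<in> carrier G \<Longrightarrow> c x = 0 \<longleftrightarrow> x = \<one>"
    and inv: "\<And>x. x \<in> carrier G \<Longrightarrow> c (inv x) = c x"
    and no: "\<And>f :: nat \<Rightarrow> nat. \<lbrakk>bij_betw f {0..m} {0..m}; f 0 = 0;
      \<And>x y. x \<in> carrier G \<Longrightarrow> y \<in> carrier G \<Longrightarrow> f (c (x \<otimes> y)) \<le> f (c x) + f (c y)\<rbrakk> \<Longrightarrow> False"
  shows "has_non_P_interval_metric G"
proof -
  define w where "w x = (if c x = 0 then 0 else m + c x)" for x
  have le: "c x \<le> m" if "x \<in> carrier G" for x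
    using range that by auto
  obtain d where d: "invariant_metric G d"
    and wd: "\<And>x. x \<in> carrier G \<Longrightarrow> weight G d x = w x"
  proof (rule invariant_metric_of_weight)
    show "w x = 0 \<longleftrightarrow> x = \<one>" if "x \<in> carrier G" for x
      using zero[OF that] by (auto simp: w_def)
    show "w (inv x) = w x" if "x \<in> carrier G" for x
      by (simp add: w_def inv that)
    show "w (x \<otimes> y) \<le> w x + w y" if "x \<in> carrier G" "y \<in> carrier G" for x y
      using le[of x] le[of y] le[of "x \<otimes> y"] zero[of x] zero[of y] that by (auto simp: w_def)
  qed (rule that)
  have "\<not> P_interval G d"
  proof
    assume "P_interval G d"
    then obtain d' where d': "interval_metric G d'"
      and eq: "metric_partition G d = metric_partition G d'"
      by (auto simp: P_interval_def)
    then have inv': "invariant_metric G d'"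
      by (simp add: interval_metric_def)
    obtain k where k: "weight G d' ` carrier G = real ` {0..k}"
      using d' by (auto simp: interval_metric_def)
    have same: "weight G d' x = weight G d' y \<longleftrightarrow> c x = c y"
      if "x \<in> carrier G" "y \<in> carrier G" for x y
      using metric_partition_eq_imp_weight_eq_iff[OF eq that] wd that
      by (auto simp: w_def split: if_splits)
    \<comment> \<open>For \<open>i \<le> m\<close> this is the weight under \<open>d'\<close> of any
      element of colour \<open>i\<close>. Such weights are natural numbers, so \<open>nat\<close>
      and the floor only change the type.\<close>
    define f where "f i = nat \<lfloor>weight G d' (inv_into (carrier G) c i)\<rfloor>" for i
    have fc: "weight G d' x = f (c x)" if x: "x \<in> carrier G" for x
    proof -
      from x have "weight G d' x \<in> real ` {0..k}"
        using k by blast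
      moreover have "weight G d' (inv_into (carrier G) c (c x)) = weight G d' x"
        using x by (subst same) (auto simp: f_inv_into_f inv_into_into)
      ultimately show ?thesis
        by (auto simp: f_def)
    qed
    have inj: "inj_on f {0..m}"
      unfolding range[symmetric] using same fc by (auto simp: inj_on_def)
    have "real ` f ` {0..m} = real ` {0..k}"
      unfolding range[symmetric] k[symmetric] using fc by (force simp: image_iff)
    \<comment> \<open>As \<open>f\<close> is injective on the \<open>m + 1\<close> colours, counting
      its image yields \<open>k = m\<close>; the number of parts need not be computed.\<close>
    then have im: "f ` {0..m} = {0..k}"
      by (simp add: inj_image_eq_iff)
    with card_image[OF inj] have "k = m"
      by simp
    with inj im have "bij_betw f {0..m} {0..m}"
      by (simp add: bij_betw_def)
    moreover have "f 0 = 0"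
    proof -
      have c0: "c \<one> = 0"
        by (simp add: zero)
      interpret Metric_space "carrier G" d'
        using inv' by (simp add: invariant_metric_def)
      have "d' \<one> \<one> = 0"
        by simp
      with c0 fc[of \<one>] show ?thesis
        by (simp add: weight_def)
    qed
    moreover have "f (c (x \<otimes> y)) \<le> f (c x) + f (c y)" if "x \<in> carrier G" "y \<in> carrier G" for x y
      using weight_mult_le[OF inv' that] fc that by (simp flip: of_nat_add)
    ultimately show False
      by (rule no)
  qed
  with d show ?thesis
    by (auto simp: has_non_P_interval_metric_def)
qed

definition meets :: "'a set \<Rightarrow> 'a set \<Rightarrow> 'a set \<Rightarrow> bool" where
  "meets X Y Z \<longleftrightarrow> (\<exists>x \<in> X. \<exists>y \<in> Y. x \<otimes> y \<in> Z)"

text \<open>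
  A triple witness \<open>z = x y\<close> also gives \<open>x = z y\<inverse>\<close> and \<open>y = x\<inverse> z\<close>, so each of the three
  weights is at most the sum of the other two.
\<close>

lemma has_non_P_interval_metric_four_classes:
  assumes sub: "A \<subseteq> carrier G" "B \<subseteq> carrier G" "C \<subseteq> carrier G"
    and one: "\<one> \<notin> A" "\<one> \<notin> B" "\<one> \<notin> C"
    and disj: "A \<inter> B = {}" "A \<inter> C = {}" "B \<inter> C = {}"
    and inv: "\<And>x. x \<in> A \<Longrightarrow> inv x \<in> A" "\<And>x. x \<in> B \<Longrightarrow> inv x \<in> B" "\<And>x. x \<in> C \<Longrightarrow> inv x \<in> C"
    and D: "D = carrier G - insert \<one> (A \<union> B \<union> C)"
    and meets: "meets A B C" "meets A B D" "meets A C D" "meets B C D"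
  shows "has_non_P_interval_metric G"
proof -
  define c :: "'a \<Rightarrow> nat" where "c x = (if x = \<one> then 0 else if x \<in> A then 1 else if x \<in> B then 2
    else if x \<in> C then 3 else 4)" for x
  have c: "c x = 0 \<longleftrightarrow> x = \<one>" "c x = 1 \<longleftrightarrow> x \<in> A" "c x = 2 \<longleftrightarrow> x \<in> B" "c x = 3 \<longleftrightarrow> x \<in> C"
    "c x = 4 \<longleftrightarrow> x \<in> D" "c x \<le> 4" if "x \<in> carrier G" for x
    using that one disj by (auto simp: c_def D)
  obtain a b c' d where ne: "a \<in> A" "b \<in> B" "c' \<in> C" "d \<in> D"
    using meets unfolding meets_def by blast
  have D_sub: "D \<subseteq> carrier G"
    by (auto simp: D)
  have inv_iff: "inv x \<in> X \<longleftrightarrow> x \<in> X"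
    if "x \<in> carrier G" "\<And>x. x \<in> X \<Longrightarrow> inv x \<in> X" for x X
    using that by (metis inv_inv)
  have cinv: "c (inv x) = c x" if x: "x \<in> carrier G" for x
    using inv_iff[OF x inv(1)] inv_iff[OF x inv(2)] inv_iff[OF x inv(3)] x
    by (simp add: c_def)
  show ?thesis
  proof (rule has_non_P_interval_metricI)
    have "{0, 1, 2, 3, 4} \<subseteq> c ` carrier G"
    proof -
      have "c \<one> \<in> c ` carrier G" "c a \<in> c ` carrier G" "c b \<in> c ` carrier G"
        "c c' \<in> c ` carrier G" "c d \<in> c ` carrier G"
        using ne sub D_sub by blast+
      moreover have "c \<one> = 0" "c a = 1" "c b = 2" "c c' = 3" "c d = 4"
        using ne c sub D_sub by auto
      ultimately show ?thesis
        by simp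
    qed
    moreover have "{0, 1, 2, 3, 4} = {0..4::nat}"
      by auto
    moreover have "c ` carrier G \<subseteq> {0..4}"
      using c(6) by auto
    ultimately show "c ` carrier G = {0..4}"
      by (metis subset_antisym)
    show "c x = 0 \<longleftrightarrow> x = \<one>" if "x \<in> carrier G" for x
      using c(1) that by simp
    show "c (inv x) = c x" if "x \<in> carrier G" for x
      using that by (rule cinv)
  next
    fix f :: "nat \<Rightarrow> nat"
    assume f: "bij_betw f {0..4} {0..4}" and f0: "f 0 = 0"
      and le: "\<And>x y. x \<in> carrier G \<Longrightarrow> y \<in> carrier G \<Longrightarrow> f (c (x \<otimes> y)) \<le> f (c x) + f (c y)"
    have triangle: "f k \<le> f i + f j \<and> f j \<le> f i + f k \<and> f i \<le> f k + f j"
      if m: "meets X Y Z" and i: "\<forall>x \<in> X. x \<in> carrier G \<and> c x = i"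
        "\<forall>x \<in> Y. x \<in> carrier G \<and> c x = j" "\<forall>x \<in> Z. x \<in> carrier G \<and> c x = k" for X Y Z i j k
    proof -
      from m obtain x y where xy: "x \<in> X" "y \<in> Y" "x \<otimes> y \<in> Z"
        by (auto simp: meets_def)
      with i have *: "x \<in> carrier G" "y \<in> carrier G" "c x = i" "c y = j" "c (x \<otimes> y) = k"
        by auto
      have "inv x \<otimes> (x \<otimes> y) = y" "x \<otimes> y \<otimes> inv y = x"
        using * by (simp_all add: m_assoc[of x y "inv y"] m_assoc[of "inv x" x y, symmetric])
      with le[of x y] le[of "inv x" "x \<otimes> y"] le[of "x \<otimes> y" "inv y"] * show ?thesis
        by (simp add: cinv)
    qed
    have cls: "\<forall>x \<in> A. x \<in> carrier G \<and> c x = 1" "\<forall>x \<in> B. x \<in> carrier G \<and> c x = 2"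
      "\<forall>x \<in> C. x \<in> carrier G \<and> c x = 3" "\<forall>x \<in> D. x \<in> carrier G \<and> c x = 4"
      using c(2) c(3) c(4) c(5) sub D_sub by (simp_all add: subset_iff)
    note ineqs = triangle[OF meets(1) cls(1,2,3)] triangle[OF meets(2) cls(1,2,4)]
      triangle[OF meets(3) cls(1,3,4)] triangle[OF meets(4) cls(2,3,4)]
    \<comment> \<open>Four triples of classes with three inequalities each cover every choice of
      distinct \<open>i\<close>, \<open>j\<close>, \<open>k\<close>.\<close>
    have distinct_le: "\<forall>i \<in> {1, 2, 3, 4}. \<forall>j \<in> {1, 2, 3, 4}. \<forall>k \<in> {1, 2, 3, 4}.
        i \<noteq> j \<longrightarrow> i \<noteq> k \<longrightarrow> j \<noteq> k \<longrightarrow> f k \<le> f i + f j"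
      using ineqs by (simp add: add.commute)
    have onto: "\<exists>i \<le> 4. f i = l" if "l \<le> 4" for l
    proof -
      have "l \<in> f ` {0..4}"
        using f that by (simp add: bij_betw_def)
      then show ?thesis
        by auto
    qed
    \<comment> \<open>The classes renumbered 1, 2 and 4; none of them is \<open>{\<one>}\<close>,
      because \<open>f 0 = 0\<close>.\<close>
    obtain i where i: "i \<le> 4" "f i = 1"
      using onto[of 1] by auto
    obtain j where j: "j \<le> 4" "f j = 2"
      using onto[of 2] by auto
    obtain k where k: "k \<le> 4" "f k = 4"
      using onto[of 4] by auto
    have "i \<noteq> 0" "j \<noteq> 0" "k \<noteq> 0"
      using i j k f0 by (metis zero_neq_one zero_neq_numeral)+
    with i j k have "i \<in> {1, 2, 3, 4}" "j \<in> {1, 2, 3, 4}" "k \<in> {1, 2, 3, 4}"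
      by auto
    moreover have "i \<noteq> j" "i \<noteq> k" "j \<noteq> k"
      using i j k by auto
    ultimately have "f k \<le> f i + f j"
      using distinct_le by blast
    with i j k show False
      by simp
  qed
qed

section \<open>Groups with elements satisfying x y x = y\<close>

text \<open>Conjugation by \<open>y\<close> inverts \<open>x\<close>, so elements that commute with
  \<open>x\<close> behave like rotations and their products with \<open>y\<close> like reflections.
  The work lies in showing that the classes are disjoint and that the fourth one is reached.\<close>

lemma has_non_P_interval_metric_dihedral_like:
  assumes x: "x \<in> carrier G" and y: "y \<in> carrier G" and rel: "x \<otimes> y \<otimes> x = y"
    and x2: "x \<otimes> x \<noteq> \<one>" and x3: "x \<otimes> x \<otimes> x \<noteq> \<one>" and y2: "y \<otimes> y \<noteq> x \<otimes> x"
  shows "has_non_P_interval_metric G"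
proof -
  \<comment> \<open>In a dihedral group \<open>s\<close> is \<open>\<one>\<close>. In general it
    commutes with \<open>x\<close> and \<open>y\<close> and keeps inverses of reflections in the
    form \<open>p \<otimes> y\<close>: \<open>inv y = s \<otimes> y\<close> and
    \<open>inv (x \<otimes> y) = (x \<otimes> s) \<otimes> y\<close>.\<close>
  define s where "s = inv (y \<otimes> y)"
  have s: "s \<in> carrier G"
    using y by (simp add: s_def)
  have yx: "x \<otimes> y = y \<otimes> inv x" "y \<otimes> x = inv x \<otimes> y"
    using rel x y by (metis inv_solve_right m_closed, metis inv_solve_left m_assoc m_closed)
  have "(y \<otimes> y) \<otimes> x = x \<otimes> (y \<otimes> y)"
  proof -
    have "(y \<otimes> y) \<otimes> x = (y \<otimes> inv x) \<otimes> y"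
      using x y by (simp add: m_assoc yx(2))
    then show ?thesis
      using x y by (simp add: m_assoc flip: yx(1))
  qed
  then have sx: "s \<otimes> x = x \<otimes> s"
    unfolding s_def using x y by (metis inv_closed inv_solve_left inv_solve_right m_assoc m_closed)
  have inv_y: "inv y = s \<otimes> y"
    using y by (simp add: s_def inv_mult_group m_assoc)
  have inv_xy: "inv (x \<otimes> y) = (x \<otimes> s) \<otimes> y"
  proof -
    have "inv (x \<otimes> y) = x \<otimes> inv y"
      using x y by (metis yx(1) inv_closed inv_inv inv_mult_group)
    then show ?thesis
      using x y s by (simp add: inv_y m_assoc)
  qed
  \<comment> \<open>Rotations differ from reflections: multiplying by \<open>x\<close> on both sides
    fixes \<open>p \<otimes> y\<close> but turns \<open>q\<close> into q x^2, and x^2 is not the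
    identity.\<close>
  have nocomm: "p \<otimes> y \<noteq> q"
    if p: "p \<in> carrier G" "p \<otimes> x = x \<otimes> p" and q: "q \<in> carrier G" "q \<otimes> x = x \<otimes> q" for p q
  proof
    assume eq: "p \<otimes> y = q"
    have "x \<otimes> (p \<otimes> y) \<otimes> x = p \<otimes> (x \<otimes> y \<otimes> x)"
      using p x y by (metis m_assoc m_closed)
    then have "q \<otimes> (x \<otimes> x) = q"
      using q x by (simp add: eq rel flip: m_assoc)
    with x2 x q show False
      by (simp add: r_cancel_one)
  qed
  have comm: "inv x \<otimes> x = x \<otimes> inv x" "(x \<otimes> x) \<otimes> x = x \<otimes> (x \<otimes> x)"
    "inv (x \<otimes> x) \<otimes> x = x \<otimes> inv (x \<otimes> x)" "(x \<otimes> s) \<otimes> x = x \<otimes> (x \<otimes> s)"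
    subgoal using x by simp
    subgoal using x by (simp add: m_assoc)
    subgoal using x by (simp add: inv_mult_group m_assoc) (simp flip: m_assoc)
    subgoal using x s by (simp add: m_assoc sx)
    done
  have xne: "x \<noteq> \<one>" "x \<otimes> x \<noteq> x" "x \<otimes> x \<noteq> inv x" "x \<noteq> inv (x \<otimes> x)" "inv x \<noteq> inv (x \<otimes> x)"
    "inv x \<noteq> \<one>" "inv x \<noteq> x" "inv (x \<otimes> x) \<noteq> \<one>"
  proof -
    show x1: "x \<noteq> \<one>"
      using x2 by auto
    then show xx: "x \<otimes> x \<noteq> x" "inv x \<noteq> \<one>"
      using x by auto
    then show "inv x \<noteq> inv (x \<otimes> x)"
      using x by (metis inv_inv m_closed)
    show "x \<otimes> x \<noteq> inv x"
      using x x3 by (metis l_inv)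
    then show "x \<noteq> inv (x \<otimes> x)"
      using x by (metis inv_inv m_closed)
    show "inv x \<noteq> x"
      using x x2 by (metis l_inv)
    show "inv (x \<otimes> x) \<noteq> \<one>"
      using x x2 by simp
  qed
  have sy: "s \<otimes> y = y \<otimes> s"
    using y by (simp add: s_def inv_mult_group m_assoc) (simp flip: m_assoc)
  \<comment> \<open>\<open>s\<close> commutes with \<open>y\<close>, whereas \<open>x\<close> and
    \<open>inv x\<close> do not. If \<open>s\<close> were x^2, then y x^2 = x^-2 y would make it
    x^-2 as well, and that is excluded by \<open>y2\<close>.\<close>
  have sne: "s \<noteq> x" "s \<noteq> inv x" "s \<noteq> x \<otimes> x" "s \<noteq> inv (x \<otimes> x)"
  proof -
    have xy: "y \<otimes> x \<noteq> x \<otimes> y"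
      using nocomm[of \<one> y] x y by auto
    with sy show "s \<noteq> x"
      by metis
    show "s \<noteq> inv x"
      using xy sy yx by metis
    show s4: "s \<noteq> inv (x \<otimes> x)"
      using y2 x y unfolding s_def by (metis inv_inv m_closed)
    have "y \<otimes> (x \<otimes> x) = inv (x \<otimes> x) \<otimes> y"
    proof -
      have "y \<otimes> (x \<otimes> x) = (y \<otimes> x) \<otimes> x"
        using x y by (simp add: m_assoc)
      also have "\<dots> = inv x \<otimes> (y \<otimes> x)"
        using x y by (simp add: yx(2) m_assoc)
      also have "\<dots> = inv (x \<otimes> x) \<otimes> y"
        using x y by (simp add: yx(2) inv_mult_group m_assoc)
      finally show ?thesis .
    qed
    then show "s \<noteq> x \<otimes> x"
      using s4 sy x y by (metis inv_closed m_closed right_cancel)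
  qed
  have xs: "x \<otimes> s \<noteq> \<one>" "x \<otimes> s \<noteq> s" "x \<otimes> s \<noteq> inv x" "x \<otimes> s \<noteq> x \<otimes> x"
  proof -
    show "x \<otimes> s \<noteq> \<one>"
      using sne(2) x s by (metis inv_equality sx)
    show "x \<otimes> s \<noteq> s"
      using xne(1) x s by simp
    show "x \<otimes> s \<noteq> inv x"
    proof
      assume "x \<otimes> s = inv x"
      then have "(x \<otimes> x) \<otimes> s = \<one>"
        using x s by (simp add: m_assoc)
      then show False
        using sne(4) x s by (metis inv_equality inv_inv inv_closed m_closed)
    qed
    show "x \<otimes> s \<noteq> x \<otimes> x"
      using sne(1) x s by simp
  qed
  have r_cancel': "p \<otimes> y = q \<otimes> y \<longleftrightarrow> p = q" if "p \<in> carrier G" "q \<in> carrier G" for p q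
    using that y by simp
  have yx_ne: "\<forall>q \<in> {\<one>, x, inv x, x \<otimes> x, inv (x \<otimes> x)}.
      q \<notin> {y, s \<otimes> y, x \<otimes> y, (x \<otimes> s) \<otimes> y, inv x \<otimes> y, (x \<otimes> x) \<otimes> y}"
  proof
    fix q assume q: "q \<in> {\<one>, x, inv x, x \<otimes> x, inv (x \<otimes> x)}"
    then have *: "q \<in> carrier G" "q \<otimes> x = x \<otimes> q"
      using x comm by auto
    have "y \<noteq> q"
      using nocomm[OF _ _ *, of \<one>] x y by simp
    then show "q \<notin> {y, s \<otimes> y, x \<otimes> y, (x \<otimes> s) \<otimes> y, inv x \<otimes> y, (x \<otimes> x) \<otimes> y}"
      using nocomm[OF _ _ *, of s] nocomm[OF _ _ *, of x] nocomm[OF _ _ *, of "x \<otimes> s"]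
        nocomm[OF _ _ *, of "inv x"] nocomm[OF _ _ *, of "x \<otimes> x"] x s sx comm by auto
  qed
  \<comment> \<open>Two reflections are compared by cancelling \<open>y\<close>.\<close>
  have yy_ne: "y \<noteq> x \<otimes> y" "y \<noteq> (x \<otimes> s) \<otimes> y" "s \<otimes> y \<noteq> x \<otimes> y" "s \<otimes> y \<noteq> (x \<otimes> s) \<otimes> y"
    "\<forall>p \<in> {inv x, x \<otimes> x}. p \<otimes> y \<notin> {y, s \<otimes> y, x \<otimes> y, (x \<otimes> s) \<otimes> y}"
    using x y s xne sne xs x2 by (auto simp: r_cancel' simp del: right_cancel)
  define A B C where "A = {x, inv x}" and "B = {x \<otimes> x, inv (x \<otimes> x), y, s \<otimes> y}"
    and "C = {x \<otimes> y, (x \<otimes> s) \<otimes> y}"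
  show ?thesis
  proof (rule has_non_P_interval_metric_four_classes)
    show "A \<subseteq> carrier G" "B \<subseteq> carrier G" "C \<subseteq> carrier G"
      using x y s by (auto simp: A_def B_def C_def)
    show "\<one> \<notin> A" "\<one> \<notin> B" "\<one> \<notin> C"
      using xne x2 yx_ne unfolding A_def B_def C_def by auto
    show "A \<inter> B = {}" "A \<inter> C = {}" "B \<inter> C = {}"
      using xne yx_ne yy_ne unfolding A_def B_def C_def by auto
    show "inv z \<in> A" if "z \<in> A" for z
      using that x by (auto simp: A_def)
    show "inv z \<in> B" if "z \<in> B" for z
      using that x y s by (auto simp: B_def simp flip: inv_y)
    show "inv z \<in> C" if "z \<in> C" for z
      using that x y s by (auto simp: C_def simp flip: inv_xy)
    have D_mem: "p \<otimes> y \<in> carrier G - insert \<one> (A \<union> B \<union> C)" if p: "p \<in> {inv x, x \<otimes> x}" for p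
    proof -
      have "p \<otimes> y \<notin> {y, s \<otimes> y, x \<otimes> y, (x \<otimes> s) \<otimes> y}"
        using yy_ne(5) p by blast
      moreover have "p \<otimes> y \<notin> {\<one>, x, inv x, x \<otimes> x, inv (x \<otimes> x)}"
      proof
        assume "p \<otimes> y \<in> {\<one>, x, inv x, x \<otimes> x, inv (x \<otimes> x)}"
        from bspec[OF yx_ne this] p show False
          by (elim insertE emptyE) simp_all
      qed
      ultimately have "p \<otimes> y \<notin> insert \<one> (A \<union> B \<union> C)"
        by (simp add: A_def B_def C_def)
      then show ?thesis
        using p x y by auto
    qed
    \<comment> \<open>These two elements witness the fourth class: x^-1 times y, x times xy = x^2 y,
      and x^-2 times xy = x^-1 y.\<close>
    have D: "inv x \<otimes> y \<in> carrier G - insert \<one> (A \<union> B \<union> C)"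
      "(x \<otimes> x) \<otimes> y \<in> carrier G - insert \<one> (A \<union> B \<union> C)"
      by (rule D_mem; simp)+
    show "meets A B C"
      using x y by (auto simp: meets_def A_def B_def C_def)
    show "meets A B (carrier G - insert \<one> (A \<union> B \<union> C))"
      unfolding meets_def
      by (rule bexI[of _ "inv x"], rule bexI[of _ y]) (use D y in \<open>auto simp: A_def B_def\<close>)
    show "meets A C (carrier G - insert \<one> (A \<union> B \<union> C))"
      unfolding meets_def
      by (rule bexI[of _ x], rule bexI[of _ "x \<otimes> y"]) (use D x y in \<open>auto simp: A_def C_def m_assoc\<close>)
    show "meets B C (carrier G - insert \<one> (A \<union> B \<union> C))"
      unfolding meets_def
      by (rule bexI[of _ "inv (x \<otimes> x)"], rule bexI[of _ "x \<otimes> y"])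
        (use D x y in \<open>auto simp: B_def C_def inv_mult_group m_assoc simp flip: m_assoc[of "inv x" x y]\<close>)
  qed simp
qed

end

section \<open>Symmetric groups\<close>

lemma sym_group_has_non_P_interval_metric:
  assumes "4 \<le> n"
  shows "has_non_P_interval_metric (sym_group n)"
proof -
  interpret group "sym_group n"
    by (rule sym_group_is_group)
  \<comment> \<open>\<open>x\<close> is the 4-cycle 1, 2, 3, 4 and \<open>y\<close> the reflection
    of this square in the diagonal through 2 and 4.\<close>
  define x y :: "nat \<Rightarrow> nat" where "x = Transposition.transpose 1 2 \<circ> Transposition.transpose 2 3 \<circ>
      Transposition.transpose 3 4"
    and "y = Transposition.transpose 1 3"
  have vals: "x 1 = 2" "x 2 = 3" "x 3 = 4" "x 4 = 1" "y 1 = 3"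
    by (simp_all add: x_def y_def Transposition.transpose_def)
  have "x permutes {1..n}" "y permutes {1..n}"
    using assms unfolding x_def y_def by (auto intro!: permutes_compose permutes_swap_id)
  moreover have "x \<circ> y \<circ> x = y"
    by (auto simp: x_def y_def Transposition.transpose_def fun_eq_iff)
  moreover have "x \<circ> x \<noteq> id" "x \<circ> x \<circ> x \<noteq> id" "y \<circ> y \<noteq> x \<circ> x"
  proof -
    have "(x \<circ> x) 1 \<noteq> id 1" "(x \<circ> x \<circ> x) 1 \<noteq> id 1" "(y \<circ> y) 1 \<noteq> (x \<circ> x) 1"
      by (simp_all add: vals[simplified] y_def)
    then show "x \<circ> x \<noteq> id" "x \<circ> x \<circ> x \<noteq> id" "y \<circ> y \<noteq> x \<circ> x"
      by metis+
  qed
  ultimately show ?thesis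
    by (intro has_non_P_interval_metric_dihedral_like[of x y])
      (auto simp: sym_group_carrier sym_group_mult sym_group_one)
qed

section \<open>Cyclic groups\<close>

lemma integer_mod_group_has_non_P_interval_metric:
  assumes n: "14 \<le> n"
  shows "has_non_P_interval_metric (integer_mod_group n)"
proof -
  interpret group "integer_mod_group n"
    by simp
  define N where "N = int n"
  have N: "14 \<le> N"
    using n by (simp add: N_def)
  have car: "carrier (integer_mod_group n) = {0..<N}"
    using n by (simp add: carrier_integer_mod_group N_def)
  define A B C where "A = {1, N - 1}" and "B = {2, N - 2, 6, N - 6}" and "C = {3, N - 3}"
  show ?thesis
  proof (rule has_non_P_interval_metric_four_classes)
    show sub: "A \<subseteq> carrier (integer_mod_group n)" "B \<subseteq> carrier (integer_mod_group n)"
      "C \<subseteq> carrier (integer_mod_group n)"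
      using N by (auto simp: car A_def B_def C_def)
    have inv: "inv\<^bsub>integer_mod_group n\<^esub> z = N - z" if "0 < z" "z < N" for z
      using that by (simp add: car zmod_zminus1_eq_if flip: N_def)
    show "inv\<^bsub>integer_mod_group n\<^esub> z \<in> A" if "z \<in> A" for z
      using that N by (auto simp: A_def inv)
    show "inv\<^bsub>integer_mod_group n\<^esub> z \<in> B" if "z \<in> B" for z
      using that N by (auto simp: B_def inv)
    show "inv\<^bsub>integer_mod_group n\<^esub> z \<in> C" if "z \<in> C" for z
      using that N by (auto simp: C_def inv)
    define D where "D = carrier (integer_mod_group n) - insert \<one>\<^bsub>integer_mod_group n\<^esub> (A \<union> B \<union> C)"
    \<comment> \<open>Since \<open>14 \<le> N\<close>, the residues from 0 to 6 all lie below
      \<open>N - 6\<close>, so 4 and 5 are left for the fourth class.\<close>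
    have D: "4 \<in> D" "5 \<in> D"
      using N by (auto simp: D_def car A_def B_def C_def)
    \<comment> \<open>The sums of \<plusminus>1 and \<plusminus>2 are only \<plusminus>1 and
      \<plusminus>3. This is why \<open>B\<close> also contains 6: the sum -1 + 6 = 5, computed as
      \<open>(N - 1) + 6\<close>, reaches the fourth class.\<close>
    have mod: "(N + 5) mod N = 5"
      using N by simp
    show "meets A B C"
      unfolding meets_def using N
      by (intro bexI[of _ 1] bexI[of _ 2]) (auto simp: A_def B_def C_def simp flip: N_def)
    show "meets A B (carrier (integer_mod_group n) - insert \<one>\<^bsub>integer_mod_group n\<^esub> (A \<union> B \<union> C))"
      unfolding meets_def D_def[symmetric] using N D mod
      by (intro bexI[of _ "N - 1"] bexI[of _ 6]) (auto simp: A_def B_def simp flip: N_def)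
    show "meets A C (carrier (integer_mod_group n) - insert \<one>\<^bsub>integer_mod_group n\<^esub> (A \<union> B \<union> C))"
      unfolding meets_def D_def[symmetric] using N D
      by (intro bexI[of _ 1] bexI[of _ 3]) (auto simp: A_def C_def simp flip: N_def)
    show "meets B C (carrier (integer_mod_group n) - insert \<one>\<^bsub>integer_mod_group n\<^esub> (A \<union> B \<union> C))"
      unfolding meets_def D_def[symmetric] using N D
      by (intro bexI[of _ 2] bexI[of _ 3]) (auto simp: B_def C_def simp flip: N_def)
  qed (use N in \<open>auto simp: A_def B_def C_def\<close>)
qed

section \<open>Elementary abelian 2-groups and direct products with them\<close>

text \<open>Characteristic vectors turn the group operation into symmetric difference of sets. The
  restriction to \<open>{..<r}\<close> is needed because elements of \<open>product_group\<close>
  are extensional functions.\<close>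

definition z2_vec :: "nat \<Rightarrow> nat set \<Rightarrow> nat \<Rightarrow> int" where
  "z2_vec r S = (\<lambda>i \<in> {..<r}. if i \<in> S then 1 else 0)"

lemma group_Z2_power: "group (Z2_power r)"
  by (simp add: Z2_power_def)

lemma z2_vec_carrier [simp]: "z2_vec r S \<in> carrier (Z2_power r)"
  by (auto simp: Z2_power_def z2_vec_def carrier_integer_mod_group)

lemma z2_vec_mult [simp]:
  "z2_vec r S \<otimes>\<^bsub>Z2_power r\<^esub> z2_vec r T = z2_vec r (S - T \<union> (T - S))"
  by (auto simp: Z2_power_def z2_vec_def fun_eq_iff)

lemma Z2_power_one: "\<one>\<^bsub>Z2_power r\<^esub> = z2_vec r {}"
  by (auto simp: Z2_power_def z2_vec_def)

lemma z2_vec_inv [simp]: "inv\<^bsub>Z2_power r\<^esub> z2_vec r S = z2_vec r S"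
  by (rule group.inv_equality[OF group_Z2_power]) (simp_all add: Z2_power_one)

lemma z2_vec_eq_iff:
  assumes "S \<subseteq> {..<r}" "T \<subseteq> {..<r}"
  shows "z2_vec r S = z2_vec r T \<longleftrightarrow> S = T"
proof
  assume "z2_vec r S = z2_vec r T"
  then have "z2_vec r S i = z2_vec r T i" for i
    by (rule fun_cong)
  then have "i \<in> S \<longleftrightarrow> i \<in> T" if "i < r" for i
    using that by (fastforce simp: z2_vec_def split: if_splits)
  with assms show "S = T"
    by blast
qed simp

lemma Z2_power_has_non_P_interval_metric:
  assumes r: "3 \<le> r"
  shows "has_non_P_interval_metric (Z2_power r)"
proof -
  interpret group "Z2_power r"
    by (rule group_Z2_power)
  let ?e = "z2_vec r"
  \<comment> \<open>The vectors of \<open>{0}\<close>, \<open>{1}\<close>, \<open>{2}\<close> play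
    the roles of g, u, v.\<close>
  define A B C where "A = {?e {1, 2}}" and "B = {?e {0, 1, 2}, ?e {2}}" and "C = {?e {0, 2}, ?e {1}}"
  note defs = A_def B_def C_def
  have neq: "?e S \<noteq> ?e T" if "S \<noteq> T" "S \<subseteq> {0, 1, 2}" "T \<subseteq> {0, 1, 2}" for S T
  proof -
    have "S \<subseteq> {..<r}" "T \<subseteq> {..<r}"
      using r that by auto
    with that show ?thesis
      by (simp add: z2_vec_eq_iff)
  qed
  have set_neq: "{1, 2} \<noteq> {0, 1, 2::nat}" "{1, 2} \<noteq> {0, 2::nat}" "{0, 2} \<noteq> {0, 1, 2::nat}"
    "{0} \<noteq> {1, 2::nat}" "{0} \<noteq> {0, 1, 2::nat}" "{0} \<noteq> {0, 2::nat}"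
    "{0, 1} \<noteq> {1, 2::nat}" "{0, 1} \<noteq> {0, 1, 2::nat}" "{0, 1} \<noteq> {0, 2::nat}"
    by (simp_all add: set_eq_subset)
  let ?D = "carrier (Z2_power r) - insert \<one>\<^bsub>Z2_power r\<^esub> (A \<union> B \<union> C)"
  \<comment> \<open>These are g and g u. The products used are (uv)v = u, (uv)(guv) = g, (uv)(gv) =
    gu and v(gv) = g.\<close>
  have D: "?e {0} \<in> ?D" "?e {0, 1} \<in> ?D"
    using set_neq by (simp_all add: defs Z2_power_one neq)
  show ?thesis
  proof (rule has_non_P_interval_metric_four_classes)
    show "meets A B C" "meets A B ?D" "meets A C ?D" "meets B C ?D"
      using D by (simp_all add: meets_def defs insert_Diff_if insert_commute)
    show "\<one>\<^bsub>Z2_power r\<^esub> \<notin> A" "\<one>\<^bsub>Z2_power r\<^esub> \<notin> B" "\<one>\<^bsub>Z2_power r\<^esub> \<notin> C"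
      by (simp_all add: defs Z2_power_one neq)
    show "A \<inter> B = {}" "A \<inter> C = {}" "B \<inter> C = {}"
      using set_neq by (simp_all add: defs neq neq[symmetric])
  qed (auto simp: defs)
qed

lemma DirProd_Z2_power_has_non_P_interval_metric:
  fixes G :: "('a, 'b) monoid_scheme" (structure)
  assumes "group G" "\<not> trivial_group G" and r: "2 \<le> r"
  shows "has_non_P_interval_metric (G \<times>\<times> Z2_power r)"
proof -
  interpret G: group G
    by fact
  interpret group "G \<times>\<times> Z2_power r"
    by (intro DirProd_group \<open>group G\<close> group_Z2_power)
  obtain g where g: "g \<in> carrier G" "g \<noteq> \<one>"
    using assms by (auto simp: trivial_group_def)
  let ?e = "z2_vec r" and ?P = "G \<times>\<times> Z2_power r"
  \<comment> \<open>Here u and v come from the coordinates 0 and 1 of the second factor. As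
    \<open>g\<close> need not be an involution, \<open>inv g\<close> is added to keep the classes
    closed under inverses.\<close>
  define A B C where "A = {(\<one>, ?e {0, 1})}" and "B = {(g, ?e {0, 1}), (inv g, ?e {0, 1}), (\<one>, ?e {1})}"
    and "C = {(g, ?e {1}), (inv g, ?e {1}), (\<one>, ?e {0})}"
  note defs = A_def B_def C_def
  have neq: "?e S = ?e T \<longleftrightarrow> S = T" if "S \<subseteq> {0, 1}" "T \<subseteq> {0, 1}" for S T
  proof -
    have "S \<subseteq> {..<r}" "T \<subseteq> {..<r}"
      using r that by auto
    then show ?thesis
      by (rule z2_vec_eq_iff)
  qed
  let ?D = "carrier ?P - insert \<one>\<^bsub>?P\<^esub> (A \<union> B \<union> C)"
  have set_neq: "{0, 1} \<noteq> {0::nat}" "{0, 1} \<noteq> {1::nat}" "{0::nat} \<noteq> {0, 1}" "{1::nat} \<noteq> {0, 1}"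
    by (simp_all add: set_eq_subset)
  have D: "(g, ?e {}) \<in> ?D" "(g, ?e {0}) \<in> ?D"
    using g set_neq by (simp_all add: defs Z2_power_one neq)
  have inv: "inv\<^bsub>?P\<^esub> (h, ?e S) = (inv h, ?e S)" if "h \<in> carrier G" for h S
    using that by (simp add: inv_DirProd assms(1) group_Z2_power)
  show ?thesis
  proof (rule has_non_P_interval_metric_four_classes)
    show "meets A B C" "meets A B ?D" "meets A C ?D" "meets B C ?D"
      using D g by (simp_all add: meets_def defs insert_Diff_if)
    show "\<one>\<^bsub>?P\<^esub> \<notin> A" "\<one>\<^bsub>?P\<^esub> \<notin> B" "\<one>\<^bsub>?P\<^esub> \<notin> C"
      using g by (simp_all add: defs Z2_power_one neq)
    show "A \<inter> B = {}" "A \<inter> C = {}" "B \<inter> C = {}"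
      using g set_neq by (auto simp: defs neq)
    show "A \<subseteq> carrier ?P" "B \<subseteq> carrier ?P" "C \<subseteq> carrier ?P"
      using g by (simp_all add: defs)
    show "inv\<^bsub>?P\<^esub> z \<in> A" if "z \<in> A" for z
      using that by (simp add: defs inv)
    show "inv\<^bsub>?P\<^esub> z \<in> B" if "z \<in> B" for z
      using that g unfolding defs by (elim insertE emptyE) (simp_all add: inv)
    show "inv\<^bsub>?P\<^esub> z \<in> C" if "z \<in> C" for z
      using that g unfolding defs by (elim insertE emptyE) (simp_all add: inv)
  qed simp
qed

section \<open>Dihedral and dicyclic groups, given by presentations\<close>

text \<open>An action of the letters that respects cancellation and the relations is a right action
  of the presented group. Its use is to show that two words are not equivalent.\<close>

lemma word_eq_imp_fold_eq:
  assumes "word_eq R u v"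
    and cancel: "\<And>g b s. s \<in> S \<Longrightarrow> act (g, \<not> b) (act (g, b) s) = s"
    and closed: "\<And>l s. s \<in> S \<Longrightarrow> act l s \<in> S"
    and rel: "\<And>u v s. (u, v) \<in> R \<Longrightarrow> s \<in> S \<Longrightarrow> fold act u s = fold act v s"
    and "s \<in> S"
  shows "fold act u s = fold act v s"
  using assms(1,5)
proof (induction arbitrary: s)
  case (rel u v)
  then show ?case
    by (rule assms(4))
next
  case (cancel g b)
  then show ?case
    using assms(2) by simp
next
  case (append u u' v v')
  have "fold act w t \<in> S" if "t \<in> S" for w t
    using that by (induction w arbitrary: t) (auto simp: closed)
  with append show ?case
    by simp
qed auto

lemma presented_group_has_non_P_interval_metric:
  assumes "word_eq R (x @ y @ x) y" "\<not> word_eq R (x @ x) []" "\<not> word_eq R (x @ x @ x) []"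
    "\<not> word_eq R (y @ y) (x @ x)"
  shows "has_non_P_interval_metric (presented_group R)"
proof -
  interpret group "presented_group R"
    by (rule group_presented_group)
  have "word_class R w \<in> carrier (presented_group R)" for w
    by (simp add: presented_group_def)
  moreover have "\<one>\<^bsub>presented_group R\<^esub> = word_class R []"
    by (simp add: presented_group_def)
  ultimately show ?thesis
    using assms
    by (intro has_non_P_interval_metric_dihedral_like[of "word_class R x" "word_class R y"])
      (simp_all add: presented_group_mult word_class_eq_iff)
qed

text \<open>The dihedral group acting on the vertices of an \<open>n\<close>-gon, taken as residues
  modulo \<open>n\<close>. \<open>Tau\<close> and its formal inverse act alike, since negation is an
  involution.\<close>

fun dihedral_act :: "int \<Rightarrow> dihedral_gen \<times> bool \<Rightarrow> int \<Rightarrow> int" where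
  "dihedral_act n (Rho, b) i = (if b then i + 1 else i - 1) mod n"
| "dihedral_act n (Tau, b) i = (- i) mod n"

lemma dihedral_act_funpow:
  assumes "0 \<le> i" "i < n"
  shows "(dihedral_act n (Rho, True) ^^ k) i = (i + int k) mod n"
  using assms by (induction k) (simp_all add: mod_simps ac_simps)

lemma dihedral_group_has_non_P_interval_metric:
  assumes n: "4 \<le> n"
  shows "has_non_P_interval_metric (dihedral_group n)"
proof -
  let ?R = "{(replicate n (Rho, True), []), ([(Tau, True), (Tau, True)], []),
      ([(Tau, True), (Rho, True), (Tau, True), (Rho, True)], [])}"
  let ?act = "dihedral_act (int n)"
  let ?r = "(Rho, True)" and ?t = "(Tau, True)"
  have inv: "fold ?act u 0 = fold ?act v 0" if "word_eq ?R u v" for u v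
  proof (rule word_eq_imp_fold_eq[OF that])
    show "?act (g, \<not> b) (?act (g, b) s) = s" if "s \<in> {0..<int n}" for g b s
      using that by (cases g) (auto simp: mod_simps)
    show "?act l s \<in> {0..<int n}" for l s
      using n by (cases l; cases "fst l") auto
    show "fold ?act u s = fold ?act v s" if "(u, v) \<in> ?R" "s \<in> {0..<int n}" for u v s
      using that by (auto simp: dihedral_act_funpow mod_simps)
  qed (use n in auto)
  have tt: "word_eq ?R [?t, ?t] []" and trtr: "word_eq ?R [?t, ?r, ?t, ?r] []"
    by (auto intro: word_eq.rel)
  \<comment> \<open>Prefixing \<open>[?t, ?t]\<close>, which is trivial, exposes the relator
    \<open>trtr\<close> and leaves \<open>[?t]\<close>.\<close>
  have "word_eq ?R [?r, ?t, ?r] ([?t, ?t] @ [?r, ?t, ?r])"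
    using word_eq.sym[OF word_eq.append[OF tt word_eq.refl[of ?R "[?r, ?t, ?r]"]]] by simp
  moreover have "word_eq ?R ([?t, ?t] @ [?r, ?t, ?r]) [?t]"
    using word_eq.append[OF word_eq.refl[of ?R "[?t]"] trtr] by simp
  ultimately have "word_eq ?R [?r, ?t, ?r] [?t]"
    by (rule word_eq.trans)
  \<comment> \<open>Starting from 0, the words reach the residues 2, 3 and, for
    \<open>[?t, ?t]\<close>, 0; \<open>4 \<le> n\<close> keeps 2 and 3 apart from 0.\<close>
  moreover have "\<not> word_eq ?R [?r, ?r] []" "\<not> word_eq ?R [?r, ?r, ?r] []" "\<not> word_eq ?R [?t, ?t] [?r, ?r]"
    using n by (auto dest!: inv simp: mod_simps)
  ultimately show ?thesis
    unfolding dihedral_group_def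
    by (intro presented_group_has_non_P_interval_metric[of _ "[?r]" "[?t]"]) simp_all
qed

text \<open>The state \<open>(i, b)\<close> stands for \<open>x\<^sup>i\<close> or \<open>x\<^sup>i y\<close>; letters act by right multiplication.\<close>

fun dicyclic_act :: "int \<Rightarrow> dicyclic_gen \<times> bool \<Rightarrow> int \<times> bool \<Rightarrow> int \<times> bool" where
  "dicyclic_act n (Dic_x, c) (i, b) = ((if b = c then i - 1 else i + 1) mod (2 * n), b)"
| "dicyclic_act n (Dic_y, c) (i, b) = ((if b = c then i + n else i) mod (2 * n), \<not> b)"

lemma dicyclic_act_funpow:
  assumes "0 \<le> i" "i < 2 * n"
  shows "(dicyclic_act n (Dic_x, True) ^^ k) (i, b) =
    ((if b then i - int k else i + int k) mod (2 * n), b)"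
  using assms by (induction k) (simp_all add: mod_simps algebra_simps)

lemma dicyclic_group_has_non_P_interval_metric:
  assumes n: "3 \<le> n"
  shows "has_non_P_interval_metric (dicyclic_group n)"
proof -
  let ?R = "{(replicate (2 * n) (Dic_x, True), []),
      ([(Dic_y, True), (Dic_y, True)], replicate n (Dic_x, True)),
      ([(Dic_y, False), (Dic_x, True), (Dic_y, True)], [(Dic_x, False)])}"
  let ?act = "dicyclic_act (int n)" and ?S = "{0..<2 * int n} \<times> (UNIV :: bool set)"
  let ?x = "(Dic_x, True)" and ?y = "(Dic_y, True)"
  \<comment> \<open>The relation y^2 = x^n, applied to a state x^i y, gives x^(i+n) y on one side
    and x^(i-n) y on the other.\<close>
  have half_turn: "(a + int n) mod (2 * int n) = (a - int n) mod (2 * int n)" for a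
    using mod_add_self2[of "a - int n" "2 * int n"] by (simp add: add.commute)
  let ?x' = "(Dic_x, False)" and ?y' = "(Dic_y, False)"
  have inv: "fold ?act u (0, False) = fold ?act v (0, False)" if "word_eq ?R u v" for u v
  proof (rule word_eq_imp_fold_eq[OF that])
    show "?act (g, \<not> b) (?act (g, b) s) = s" if "s \<in> ?S" for g b s
      using that by (cases g; cases s) (auto simp: mod_simps)
    show "?act l s \<in> ?S" for l s
      using n by (cases l; cases "fst l"; cases s) auto
    show "fold ?act u s = fold ?act v s" if "(u, v) \<in> ?R" "s \<in> ?S" for u v s
      using that by (cases s) (auto simp: dicyclic_act_funpow half_turn mod_simps)
  qed (use n in auto)
  have yxy: "word_eq ?R [?y', ?x, ?y] [?x']"
    by (auto intro: word_eq.rel)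
  \<comment> \<open>Multiplying y^-1 x y = x^-1 by y on the left gives x y = y x^-1; multiplying by
    x on the right then gives x y x = y.\<close>
  have "word_eq ?R [?x, ?y] ([?y, ?y'] @ [?x, ?y])"
    using word_eq.sym[OF word_eq.append[OF word_eq.cancel[of ?R Dic_y True] word_eq.refl[of ?R "[?x, ?y]"]]]
    by simp
  moreover have "word_eq ?R ([?y, ?y'] @ [?x, ?y]) [?y, ?x']"
    using word_eq.append[OF word_eq.refl[of ?R "[?y]"] yxy] by simp
  ultimately have "word_eq ?R [?x, ?y] [?y, ?x']"
    by (rule word_eq.trans)
  then have "word_eq ?R [?x, ?y, ?x] [?y, ?x', ?x]"
    using word_eq.append[OF _ word_eq.refl[of ?R "[?x]"]] by fastforce
  moreover have "word_eq ?R [?y, ?x', ?x] [?y]"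
    using word_eq.append[OF word_eq.refl[of ?R "[?y]"] word_eq.cancel[of ?R Dic_x False]] by simp
  ultimately have "word_eq ?R [?x, ?y, ?x] [?y]"
    by (rule word_eq.trans)
  \<comment> \<open>From \<open>(0, False)\<close> the words lead to the exponents 2, 3 and, for
    \<open>[?y, ?y]\<close>, \<open>n\<close>, taken modulo \<open>2 * n\<close>;
    \<open>3 \<le> n\<close> separates 2 and 3 from 0, and \<open>n\<close> from 2.\<close>
  moreover have "\<not> word_eq ?R [?x, ?x] []" "\<not> word_eq ?R [?x, ?x, ?x] []" "\<not> word_eq ?R [?y, ?y] [?x, ?x]"
    using n by (auto dest!: inv simp: mod_simps)
  ultimately show ?thesis
    unfolding dicyclic_group_def
    by (intro presented_group_has_non_P_interval_metric[of _ "[?x]" "[?y]"]) simp_all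
qed

theorem corollary2p13:
  "(\<forall>n \<ge> 7. has_non_P_interval_metric (integer_mod_group (2 * n))) \<and>
   (\<forall>n \<ge> 4. has_non_P_interval_metric (dihedral_group n)) \<and>
   (\<forall>n \<ge> 3. has_non_P_interval_metric (dicyclic_group n)) \<and>
   (\<forall>n \<ge> 4. has_non_P_interval_metric (sym_group n)) \<and>
   (\<forall>r \<ge> 3. has_non_P_interval_metric (Z2_power r)) \<and>
   (\<forall>(G :: ('a, 'b) monoid_scheme) r.
      group G \<and> finite (carrier G) \<and> \<not> trivial_group G \<and> r \<ge> 2 \<longrightarrow>
      has_non_P_interval_metric (G \<times>\<times> Z2_power r))"
  by (simp add: integer_mod_group_has_non_P_interval_metric dihedral_group_has_non_P_interval_metric
      dicyclic_group_has_non_P_interval_metric sym_group_has_non_P_interval_metric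
      Z2_power_has_non_P_interval_metric DirProd_Z2_power_has_non_P_interval_metric)

end
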